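(* Let $X\subseteq l_{\infty}$ and let $\tau$ be any topology on $X$. Then the following assertions hold: (1) There exists an ethical social welfare order $\precsim$ on $X$ which satisfies anonymity and sensitivity to the present, and which is $\tau$-continuous provided that $\tau$ is finer than the coarsest topology including $\tau^{\precsim}_{U}$ and $\tau^{\precsim}_{L}$. (2) There exists an ethical social welfare order $\precsim$ on $X$ which satisfies anonymity and sensitivity to the present, and which is lower $\tau$-continuous provided that $\tau$ is finer than $\tau^{\precsim}_{U}$.
   Context: $l_{\infty}$ is the set of bounded real sequences $x=(x_n)_{n\in\mathbb{N}}$. A preorder is a reflexive transitive relation $\precsim$; $x\sim y$ means $x\precsim y$ and $y\precsim x$; $x\prec y$ means $x\precsim y$ and not $y\precsim x$. A finite permutation is a bijection $\pi:\mathbb{N}\to\mathbb{N}$ for which there is $t_0$ with $\pi(t)=t$ for all $t>t_0$; $\Pi_\infty$ is the set of all of them, and $\pi(x)=(x_{\pi(n)})_{n\in\mathbb{N}}$. Axioms for a preorder $\precsim$ on $X$ (comparisons concern elements of $X$). Anonymity: $x\sim\pi(x)$ for all $x\in X$ and $\pi\in\Pi_\infty$ (with $\pi(x)\in X$). Distributive fairness semiconvexity: for all $x\in X$, $\pi\in\Pi_\infty$ with $x\ne\pi(x)$ there is $s\in(0,1)$ with $x\prec sx+(1-s)\pi(x)$ and $\pi(x)\prec sx+(1-s)\pi(x)$. Sensitivity to the present: for each $x\in X$ there are $y,z\in X$ and $t\in\mathbb{N}$ such that $(z_1,\dots,z_t,x_{t+1},x_{t+2},\dots)\prec(y_1,\dots,y_t,x_{t+1},x_{t+2},\dots)$.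 Weak monotonicity: $x\prec y$ whenever $x,y\in X$ and $x_t<y_t$ for all $t$. Strong monotonicity: $x\prec y$ whenever $x,y\in X$, $x_t\le y_t$ for all $t$ and $x\neq y$. An ethical social welfare preorder on $X$ is a preorder satisfying an equity requirement (anonymity, distributive fairness semiconvexity or sensitivity to the present) and a monotonicity requirement (strong or weak). An ethical social welfare order is an ethical social welfare preorder that is complete (total). For $y\in X$ let $L^{\precsim}(y)=\{x\in X: x\precsim y\}$ and $U^{\precsim}(y)=\{x\in X: y\precsim x\}$. $\tau^{\precsim}_{U}$ (resp. $\tau^{\precsim}_{L}$) is the topology on $X$ generated by the subbase $\{X\setminus L^{\precsim}(x)\}_{x\in X}$ (resp. $\{X\setminus U^{\precsim}(x)\}_{x\in X}$). $\precsim$ is lower $\tau$-continuous if every $L^{\precsim}(y)$ is $\tau$-closed, and $\tau$-continuous if every $L^{\precsim}(y)$ and every $U^{\precsim}(y)$ is $\tau$-closed. "$\tau$ finer than $\tau'$" means $\tau'\subseteq\tau$.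
   Formalization: Sensitivity to the present is claimed only if each x in X has two variants in X, equal to x from some time on, that are not finite permutations of each other; anonymity and sensitivity together force this, and it fails e.g. for a one-element X, where the original claim is false. *)

theory Defs
  imports "HOL-Analysis.Analysis"
begin

definition l_inf :: "(nat \<Rightarrow> real) set" where
  "l_inf = {x. bounded (range x)}"

definition fin_perms :: "(nat \<Rightarrow> nat) set" where
  "fin_perms = {p. bij p \<and> (\<exists>t0. \<forall>t>t0. p t = t)}"

(* The first t coordinates of y followed by the tail of x. Time starts at index 0, so
   (y_1, ..., y_t, x_(t+1), ...) takes its values from y exactly at the indices below t. *)
definition splice :: "nat \<Rightarrow> (nat \<Rightarrow> real) \<Rightarrow> (nat \<Rightarrow> real) \<Rightarrow> (nat \<Rightarrow> real)" where
  "splice t y x = (\<lambda>n. if n < t then y n else x n)"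

(* A preference on X is a relation R \<subseteq> X \<times> X with preorder_on X R; (x, y) \<in> R means that y is
   at least as good as x. A pair related by R therefore consists of elements of X. *)
definition indiff :: "'a rel \<Rightarrow> 'a \<Rightarrow> 'a \<Rightarrow> bool" where
  "indiff R x y \<longleftrightarrow> (x, y) \<in> R \<and> (y, x) \<in> R"

definition strictly :: "'a rel \<Rightarrow> 'a \<Rightarrow> 'a \<Rightarrow> bool" where
  "strictly R x y \<longleftrightarrow> (x, y) \<in> R \<and> (y, x) \<notin> R"

definition anonymity :: "(nat \<Rightarrow> real) set \<Rightarrow> (nat \<Rightarrow> real) rel \<Rightarrow> bool" where
  "anonymity X R \<longleftrightarrow> (\<forall>x\<in>X. \<forall>p\<in>fin_perms. x \<circ> p \<in> X \<longrightarrow> indiff R x (x \<circ> p))"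

definition distributive_fairness_semiconvexity ::
    "(nat \<Rightarrow> real) set \<Rightarrow> (nat \<Rightarrow> real) rel \<Rightarrow> bool" where
  "distributive_fairness_semiconvexity X R \<longleftrightarrow>
     (\<forall>x\<in>X. \<forall>p\<in>fin_perms. x \<circ> p \<in> X \<longrightarrow> x \<noteq> x \<circ> p \<longrightarrow>
        (\<exists>s\<in>{0<..<1::real}.
           strictly R x (\<lambda>n. s * x n + (1 - s) * (x \<circ> p) n) \<and>
           strictly R (x \<circ> p) (\<lambda>n. s * x n + (1 - s) * (x \<circ> p) n)))"

definition sensitivity_to_present :: "(nat \<Rightarrow> real) set \<Rightarrow> (nat \<Rightarrow> real) rel \<Rightarrow> bool" where
  "sensitivity_to_present X R \<longleftrightarrow>
     (\<forall>x\<in>X. \<exists>y\<in>X. \<exists>z\<in>X. \<exists>t. strictly R (splice t z x) (splice t y x))"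

definition weak_monotonicity :: "(nat \<Rightarrow> real) set \<Rightarrow> (nat \<Rightarrow> real) rel \<Rightarrow> bool" where
  "weak_monotonicity X R \<longleftrightarrow> (\<forall>x\<in>X. \<forall>y\<in>X. (\<forall>t. x t < y t) \<longrightarrow> strictly R x y)"

definition strong_monotonicity :: "(nat \<Rightarrow> real) set \<Rightarrow> (nat \<Rightarrow> real) rel \<Rightarrow> bool" where
  "strong_monotonicity X R \<longleftrightarrow>
     (\<forall>x\<in>X. \<forall>y\<in>X. (\<forall>t. x t \<le> y t) \<longrightarrow> x \<noteq> y \<longrightarrow> strictly R x y)"

definition ethical_swp :: "(nat \<Rightarrow> real) set \<Rightarrow> (nat \<Rightarrow> real) rel \<Rightarrow> bool" where
  "ethical_swp X R \<longleftrightarrow> preorder_on X R \<and>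
     (anonymity X R \<or> distributive_fairness_semiconvexity X R \<or> sensitivity_to_present X R) \<and>
     (strong_monotonicity X R \<or> weak_monotonicity X R)"

definition ethical_swo :: "(nat \<Rightarrow> real) set \<Rightarrow> (nat \<Rightarrow> real) rel \<Rightarrow> bool" where
  "ethical_swo X R \<longleftrightarrow> ethical_swp X R \<and> total_on X R"

definition lower_contour :: "'a set \<Rightarrow> 'a rel \<Rightarrow> 'a \<Rightarrow> 'a set" where
  "lower_contour X R y = {x \<in> X. (x, y) \<in> R}"

definition upper_contour :: "'a set \<Rightarrow> 'a rel \<Rightarrow> 'a \<Rightarrow> 'a set" where
  "upper_contour X R y = {x \<in> X. (y, x) \<in> R}"

(* X is added to the subbases because topology_generated_by takes the union of the subbase as
   its space, whereas here X (the empty intersection) is open even if the subbase does not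
   cover it, for instance when R has a best or a worst element. *)
definition upper_topology :: "'a set \<Rightarrow> 'a rel \<Rightarrow> 'a topology" where
  "upper_topology X R =
     topology_generated_by (insert X ((\<lambda>x. X - lower_contour X R x) ` X))"

definition lower_topology :: "'a set \<Rightarrow> 'a rel \<Rightarrow> 'a topology" where
  "lower_topology X R =
     topology_generated_by (insert X ((\<lambda>x. X - upper_contour X R x) ` X))"

definition join_topology :: "'a topology \<Rightarrow> 'a topology \<Rightarrow> 'a topology" where
  "join_topology T1 T2 = topology_generated_by ({U. openin T1 U} \<union> {U. openin T2 U})"

definition finer_topology :: "'a topology \<Rightarrow> 'a topology \<Rightarrow> bool" where
  "finer_topology T T' \<longleftrightarrow> topspace T = topspace T' \<and> (\<forall>U. openin T' U \<longrightarrow> openin T U)"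

definition lower_continuous_pref :: "'a topology \<Rightarrow> 'a set \<Rightarrow> 'a rel \<Rightarrow> bool" where
  "lower_continuous_pref T X R \<longleftrightarrow> (\<forall>y\<in>X. closedin T (lower_contour X R y))"

definition continuous_pref :: "'a topology \<Rightarrow> 'a set \<Rightarrow> 'a rel \<Rightarrow> bool" where
  "continuous_pref T X R \<longleftrightarrow>
     (\<forall>y\<in>X. closedin T (lower_contour X R y) \<and> closedin T (upper_contour X R y))"

(* Sensitivity to the present cannot hold on every X: on a singleton there is no strict
   preference at all. The following condition on X alone, without reference to any preference,
   is necessary for sensitivity in the presence of anonymity: every x has two variants in X that
   agree with x from some time on and are not finite permutations of each other. *)
definition present_variation :: "(nat \<Rightarrow> real) set \<Rightarrow> bool" where
  "present_variation X \<longleftrightarrow>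
     (\<forall>x\<in>X. \<exists>y\<in>X. \<exists>z\<in>X. \<exists>t. splice t y x \<in> X \<and> splice t z x \<in> X \<and>
        (\<forall>p\<in>fin_perms. splice t y x \<noteq> splice t z x \<circ> p))"

lemma present_variation_necessary:
  assumes "preorder_on X R" "anonymity X R" "sensitivity_to_present X R"
  shows "present_variation X"
  unfolding present_variation_def
proof
  fix x assume "x \<in> X"
  then obtain y z t where yz: "y \<in> X" "z \<in> X" and s: "strictly R (splice t z x) (splice t y x)"
    using assms(3) unfolding sensitivity_to_present_def by blast
  have mem: "splice t y x \<in> X" "splice t z x \<in> X"
    using s assms(1) unfolding strictly_def preorder_on_def by auto
  have "splice t y x \<noteq> splice t z x \<circ> p" if perm: "p \<in> fin_perms" for p
  proof
    assume eq: "splice t y x = splice t z x \<circ> p"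
    then have "indiff R (splice t z x) (splice t y x)"
      using assms(2) mem perm unfolding anonymity_def by metis
    then show False
      using s unfolding indiff_def strictly_def by blast
  qed
  then show "\<exists>y\<in>X. \<exists>z\<in>X. \<exists>t. splice t y x \<in> X \<and> splice t z x \<in> X \<and>
        (\<forall>p\<in>fin_perms. splice t y x \<noteq> splice t z x \<circ> p)"
    using yz mem by blast
qed

lemma not_sensitivity_to_present_singleton: "\<not> sensitivity_to_present {x} R"
proof -
  have "splice t x x = x" for t
    by (simp add: splice_def)
  then show ?thesis
    by (simp add: sensitivity_to_present_def strictly_def)
qed

lemma present_variation_l_inf: "present_variation l_inf"
  unfolding present_variation_def
proof
  fix x assume "x \<in> l_inf"
  then obtain B where B: "\<And>n. \<bar>x n\<bar> \<le> B"
    unfolding l_inf_def bounded_iff by auto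
  let ?c = "\<lambda>a::real. \<lambda>n::nat. a"
  have const: "?c a \<in> l_inf" for a
    by (simp add: l_inf_def image_constant_conv)
  have mem: "splice 1 (?c a) x \<in> l_inf" for a
  proof -
    have "\<bar>splice 1 (?c a) x n\<bar> \<le> max \<bar>a\<bar> B" for n
      using B[of n] by (auto simp: splice_def)
    then have "\<forall>v\<in>range (splice 1 (?c a) x). norm v \<le> max \<bar>a\<bar> B"
      by auto
    then show ?thesis
      unfolding l_inf_def bounded_iff by blast
  qed
  have "splice 1 (?c 1) x \<noteq> splice 1 (?c 0) x \<circ> p" if perm: "p \<in> fin_perms" for p
  proof
    let ?u = "splice 1 (?c 0) x" and ?v = "splice 1 (?c 1) x"
    assume eq: "?v = ?u \<circ> p"
    obtain t0 where p: "bij p" "\<And>t. t > t0 \<Longrightarrow> p t = t"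
      using perm unfolding fin_perms_def by blast
    have "p t \<le> t0" if "t \<le> t0" for t
      using that p by (metis bij_is_inj injD linorder_not_le)
    then have "p ` {..t0} \<subseteq> {..t0}"
      by auto
    then have "bij_betw p {..t0} {..t0}"
      using p(1) by (metis bij_betw_def bij_is_inj endo_inj_surj finite_atMost inj_on_subset subset_UNIV)
    then have "sum ?v {..t0} = sum ?u {..t0}"
      unfolding eq comp_def by (rule sum.reindex_bij_betw)
    moreover have "sum ?v {..t0} = 1 + sum ?v {0<..t0}" "sum ?u {..t0} = 0 + sum ?u {0<..t0}"
      using sum.head[of 0 t0 ?v] sum.head[of 0 t0 ?u] by (simp_all add: atMost_atLeast0 splice_def)
    moreover have "sum ?v {0<..t0} = sum ?u {0<..t0}"
      by (rule sum.cong) (auto simp: splice_def)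
    ultimately show False
      by simp
  qed
  then show "\<exists>y\<in>l_inf. \<exists>z\<in>l_inf. \<exists>t. splice t y x \<in> l_inf \<and> splice t z x \<in> l_inf \<and>
        (\<forall>p\<in>fin_perms. splice t y x \<noteq> splice t z x \<circ> p)"
    using const mem by blast
qed

end

theory Submission
  imports Defs
begin

text \<open>
  Compare \<open>x\<close> and \<open>y\<close> by the Suppes--Sen grading principle: \<open>x \<circ> p \<le> y\<close> for some finite
  permutation \<open>p\<close>. Comparing sums over a long initial segment shows that only
  finite permutations of each other are indifferent. A Szpilrajn extension to a total preorder that
  creates no new indifferences is therefore anonymous, strongly monotone, and strict on every pair
  that present variation provides. Continuity holds because the complements of the
  contour sets are subbasic open sets.
\<close>

text \<open>Szpilrajn's theorem for preorders. Zorn's lemma gives a maximal preorder among those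
  that extend \<open>S\<close> and have all two-way pairs in \<open>S\<close>; an incomparable pair
  could still be added to it.\<close>

lemma preorder_on_total_extension:
  assumes S: "preorder_on X S"
  obtains R where "preorder_on X R" "total_on X R" "S \<subseteq> R" "R \<inter> R\<inverse> \<subseteq> S"
proof -
  let ?\<A> = "{R. preorder_on X R \<and> S \<subseteq> R \<and> R \<inter> R\<inverse> \<subseteq> S}"
  have "\<exists>R\<in>?\<A>. \<forall>R'\<in>?\<A>. R \<subseteq> R' \<longrightarrow> R' = R"
  proof (rule subset_Zorn_nonempty)
    show "?\<A> \<noteq> {}"
      using S by blast
    show "\<Union>\<C> \<in> ?\<A>" if ne: "\<C> \<noteq> {}" and chain: "subset.chain ?\<A> \<C>" for \<C>
    proof -
      have mem: "preorder_on X R" "S \<subseteq> R" "R \<inter> R\<inverse> \<subseteq> S" if "R \<in> \<C>" for R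
        using that chain unfolding subset.chain_def by blast+
      \<comment> \<open>Transitivity and the condition on two-way pairs each involve only two pairs,
        and two pairs of the union already lie in one member of the chain.\<close>
      have common: "\<exists>R\<in>\<C>. a \<in> R \<and> b \<in> R" if "a \<in> \<Union>\<C>" "b \<in> \<Union>\<C>" for a b
      proof -
        obtain A B where "A \<in> \<C>" "B \<in> \<C>" "a \<in> A" "b \<in> B"
          using \<open>a \<in> \<Union>\<C>\<close> \<open>b \<in> \<Union>\<C>\<close> by blast
        moreover from this have "A \<subseteq> B \<or> B \<subseteq> A"
          using chain by (simp add: subset_chain_def)
        ultimately show ?thesis
          by blast
      qed
      have "trans (\<Union>\<C>)"
        by (rule transI) (metis common mem(1) preorder_on_def transD UnionI)
      moreover have "refl_on X (\<Union>\<C>)" "\<Union>\<C> \<subseteq> X \<times> X"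
        using ne mem(1) unfolding preorder_on_def refl_on_def by blast+
      moreover have "S \<subseteq> \<Union>\<C>"
        using ne mem(2) by blast
      moreover have "\<Union>\<C> \<inter> (\<Union>\<C>)\<inverse> \<subseteq> S"
        using common mem(3) by blast
      ultimately show ?thesis
        by (simp add: preorder_on_def)
    qed
  qed
  then obtain R where "R \<in> ?\<A>" and max: "\<forall>R'\<in>?\<A>. R \<subseteq> R' \<longrightarrow> R' = R" ..
  then have R: "preorder_on X R" "S \<subseteq> R" "R \<inter> R\<inverse> \<subseteq> S"
    by simp_all
  have refl: "(a, a) \<in> R" if "a \<in> X" for a
    using R(1) that by (simp add: preorder_on_def refl_on_def)
  have trans: "(a, c) \<in> R" if "(a, b) \<in> R" "(b, c) \<in> R" for a b c
    using R(1) that unfolding preorder_on_def by (blast dest: transD)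
  have sub: "R \<subseteq> X \<times> X"
    using R(1) by (simp add: preorder_on_def)
  have "total_on X R"
  proof (rule total_onI, rule ccontr)
    fix x y assume xy: "x \<in> X" "y \<in> X" "\<not> ((x, y) \<in> R \<or> (y, x) \<in> R)"
    \<comment> \<open>This is the least preorder containing \<open>R\<close> and
      \<open>(x, y)\<close>: a new pair leads from something below \<open>x\<close> to something
      above \<open>y\<close>. Chaining two new pairs, or reversing one, would put
      \<open>(y, x)\<close> into \<open>R\<close>.\<close>
    let ?R = "R \<union> {(a, b). (a, x) \<in> R \<and> (y, b) \<in> R}"
    have "trans ?R"
      by (rule transI) (use trans xy in blast)
    moreover have "refl_on X ?R" "?R \<subseteq> X \<times> X"
      using refl sub unfolding refl_on_def by blast+
    moreover have "?R \<inter> ?R\<inverse> \<subseteq> S"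
      using trans xy R(3) by blast
    ultimately have "?R \<in> ?\<A>"
      using R(2) by (simp add: preorder_on_def le_supI1)
    then have "?R = R"
      by (rule max[rule_format]) simp
    then show False
      using xy refl by blast
  qed
  then show thesis
    using R that by blast
qed

lemma id_fin_perms: "id \<in> fin_perms"
  by (simp add: fin_perms_def)

lemma comp_fin_perms:
  assumes "p \<in> fin_perms" "q \<in> fin_perms"
  shows "p \<circ> q \<in> fin_perms"
proof -
  obtain s t where "\<forall>n>s. p n = n" "\<forall>n>t. q n = n"
    using assms by (auto simp: fin_perms_def)
  then have "\<forall>n>max s t. (p \<circ> q) n = n"
    by simp
  then show ?thesis
    using assms bij_comp unfolding fin_perms_def by blast
qed

lemma inv_fin_perms:
  assumes "p \<in> fin_perms"
  shows "inv p \<in> fin_perms"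
proof -
  obtain t where "bij p" "\<forall>n>t. p n = n"
    using assms by (auto simp: fin_perms_def)
  then have "\<forall>n>t. inv p n = n"
    by (metis bij_inv_eq_iff)
  then show ?thesis
    using \<open>bij p\<close> bij_imp_bij_inv unfolding fin_perms_def by blast
qed

text \<open>Values above \<open>t\<close> are taken by the fixed points there, so \<open>p\<close>
  maps the finite set \<open>{..t}\<close> injectively into itself. Sums over \<open>{..t}\<close>
  are thus invariant under \<open>p\<close>.\<close>

lemma fin_perms_bij_betw_atMost:
  assumes "p \<in> fin_perms"
  obtains t where "\<And>n. n > t \<Longrightarrow> p n = n" "bij_betw p {..t} {..t}"
proof -
  obtain t where p: "bij p" "\<And>n. n > t \<Longrightarrow> p n = n"
    using assms unfolding fin_perms_def by blast
  have "p n \<le> t" if "n \<le> t" for n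
    using that p by (metis bij_is_inj injD linorder_not_le)
  then have "p ` {..t} \<subseteq> {..t}"
    by auto
  then have "bij_betw p {..t} {..t}"
    using p(1) by (metis bij_betw_def bij_is_inj endo_inj_surj finite_atMost inj_on_subset subset_UNIV)
  then show thesis
    using p(2) that by blast
qed

text \<open>One strict coordinate would make the sum of \<open>x \<circ> p\<close> over a long
  initial segment strictly smaller, yet \<open>p\<close> only rearranges that sum.\<close>

lemma fin_perm_le_imp_eq:
  fixes x :: "nat \<Rightarrow> 'a::ordered_cancel_comm_monoid_add"
  assumes p: "p \<in> fin_perms" and le: "x \<circ> p \<le> x"
  shows "x \<circ> p = x"
proof
  fix n
  obtain t where t: "\<And>n. n > t \<Longrightarrow> p n = n" "bij_betw p {..t} {..t}"
    using fin_perms_bij_betw_atMost[OF p] by blast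
  have eq: "sum (x \<circ> p) {..t} = sum x {..t}"
    unfolding comp_def by (rule sum.reindex_bij_betw) (rule t(2))
  show "(x \<circ> p) n = x n"
  proof (cases "n \<le> t")
    case True
    show ?thesis
    proof (rule ccontr)
      assume "(x \<circ> p) n \<noteq> x n"
      then have "(x \<circ> p) n < x n"
        using le by (simp add: le_fun_def less_le)
      then have "sum (x \<circ> p) {..t} < sum x {..t}"
        using le True by (intro sum_strict_mono_ex1) (auto simp: le_fun_def)
      then show False
        using eq by simp
    qed
  qed (simp add: t(1))
qed

text \<open>\<open>x \<circ> p\<close> need not lie in \<open>X\<close>, as \<open>X\<close> need
  not be closed under permutations.\<close>

definition suppes_sen :: "(nat \<Rightarrow> real) set \<Rightarrow> (nat \<Rightarrow> real) rel" where
  "suppes_sen X = {(x, y). x \<in> X \<and> y \<in> X \<and> (\<exists>p\<in>fin_perms. x \<circ> p \<le> y)}"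

lemma preorder_on_suppes_sen: "preorder_on X (suppes_sen X)"
proof -
  have "trans (suppes_sen X)"
  proof (rule transI)
    fix x y z assume "(x, y) \<in> suppes_sen X" "(y, z) \<in> suppes_sen X"
    then obtain p q where pq: "p \<in> fin_perms" "q \<in> fin_perms" "x \<circ> p \<le> y" "y \<circ> q \<le> z"
      and mem: "x \<in> X" "z \<in> X"
      unfolding suppes_sen_def by blast
    have "x \<circ> (p \<circ> q) \<le> z"
      using pq(3,4) unfolding le_fun_def comp_def by (meson order_trans)
    then show "(x, z) \<in> suppes_sen X"
      using mem comp_fin_perms[OF pq(1,2)] unfolding suppes_sen_def by blast
  qed
  moreover have "refl_on X (suppes_sen X)"
    unfolding refl_on_def suppes_sen_def using id_fin_perms by force
  ultimately show ?thesis
    unfolding preorder_on_def suppes_sen_def by blast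
qed

text \<open>The comparisons chain to
  \<open>x \<circ> (p \<circ> q) \<le> y \<circ> q \<le> x\<close>. The outer terms coincide by the
  sum argument, which squeezes \<open>y \<circ> q\<close>.\<close>

lemma suppes_sen_antisym:
  assumes "(x, y) \<in> suppes_sen X" "(y, x) \<in> suppes_sen X"
  shows "\<exists>p\<in>fin_perms. y \<circ> p = x"
proof -
  obtain p q where pq: "p \<in> fin_perms" "q \<in> fin_perms" "x \<circ> p \<le> y" "y \<circ> q \<le> x"
    using assms unfolding suppes_sen_def by blast
  have le: "x \<circ> (p \<circ> q) \<le> y \<circ> q"
    using pq(3) by (simp add: le_fun_def)
  then have "x \<circ> (p \<circ> q) = x"
    using pq by (intro fin_perm_le_imp_eq comp_fin_perms) auto
  then have "y \<circ> q = x"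
    using le pq(4) by (simp add: order_antisym)
  then show ?thesis
    using pq(2) by blast
qed

theorem theorem13:
  fixes X :: "(nat \<Rightarrow> real) set" and T :: "(nat \<Rightarrow> real) topology"
  assumes "X \<subseteq> l_inf" and "topspace T = X"
  shows "(\<exists>R. ethical_swo X R \<and> anonymity X R \<and>
             (present_variation X \<longrightarrow> sensitivity_to_present X R) \<and>
             (finer_topology T (join_topology (upper_topology X R) (lower_topology X R)) \<longrightarrow>
                continuous_pref T X R)) \<and>
         (\<exists>R. ethical_swo X R \<and> anonymity X R \<and>
             (present_variation X \<longrightarrow> sensitivity_to_present X R) \<and>
             (finer_topology T (upper_topology X R) \<longrightarrow> lower_continuous_pref T X R))"
proof -
  \<comment> \<open>\<open>R\<close> is built from \<open>X\<close> alone, so it serves both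
    assertions, whatever \<open>T\<close> is.\<close>
  obtain R where R: "preorder_on X R" "total_on X R" "suppes_sen X \<subseteq> R" "R \<inter> R\<inverse> \<subseteq> suppes_sen X"
    using preorder_on_total_extension[OF preorder_on_suppes_sen] .
  have indiff_perm: "\<exists>p\<in>fin_perms. y \<circ> p = x" if "(x, y) \<in> R" "(y, x) \<in> R" for x y
    using that R(4) by (intro suppes_sen_antisym) auto
  have anon: "anonymity X R"
    unfolding anonymity_def
  proof (intro ballI impI)
    fix x p assume xp: "x \<in> X" "p \<in> fin_perms" "x \<circ> p \<in> X"
    \<comment> \<open>The witness \<open>p\<close> puts \<open>x\<close> below
      \<open>x \<circ> p\<close>, and \<open>inv p\<close> gives the converse.\<close>
    then have "x \<circ> p \<circ> inv p = x"
      by (simp add: fin_perms_def comp_assoc bij_is_surj surj_iff[THEN iffD1])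
    then have "(x, x \<circ> p) \<in> suppes_sen X" "(x \<circ> p, x) \<in> suppes_sen X"
      using xp inv_fin_perms unfolding suppes_sen_def by force+
    then show "indiff R x (x \<circ> p)"
      using R(3) unfolding indiff_def by blast
  qed
  have "strong_monotonicity X R"
    unfolding strong_monotonicity_def
  proof (intro ballI impI)
    fix x y assume xy: "x \<in> X" "y \<in> X" "\<forall>t. x t \<le> y t" "x \<noteq> y"
    then have "(x, y) \<in> suppes_sen X"
      unfolding suppes_sen_def using id_fin_perms by (force simp: le_fun_def)
    then have le: "(x, y) \<in> R"
      using R(3) by blast
    \<comment> \<open>Indifference would make \<open>x\<close> a permutation
      \<open>y \<circ> p\<close> with \<open>y \<circ> p \<le> y\<close>, forcing
      \<open>x = y\<close>.\<close>
    moreover have "(y, x) \<notin> R"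
    proof
      assume "(y, x) \<in> R"
      then obtain p where "p \<in> fin_perms" "y \<circ> p = x"
        using indiff_perm le by blast
      moreover have "x \<le> y"
        using xy(3) by (simp add: le_fun_def)
      ultimately show False
        using fin_perm_le_imp_eq[of p y] xy(4) by simp
    qed
    ultimately show "strictly R x y"
      by (simp add: strictly_def)
  qed
  then have swo: "ethical_swo X R"
    using R anon by (simp add: ethical_swo_def ethical_swp_def)
  have sens: "sensitivity_to_present X R" if pv: "present_variation X"
    unfolding sensitivity_to_present_def
  proof
    fix x assume "x \<in> X"
    then obtain y z t where yz: "y \<in> X" "z \<in> X"
      and mem: "splice t y x \<in> X" "splice t z x \<in> X"
      and neq: "\<forall>p\<in>fin_perms. splice t y x \<noteq> splice t z x \<circ> p"
      using pv unfolding present_variation_def by blast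
    \<comment> \<open>Totality speaks of distinct elements only; taking the identity for
      \<open>p\<close> shows that the variants differ.\<close>
    have "(splice t y x, splice t z x) \<in> R \<or> (splice t z x, splice t y x) \<in> R"
    proof -
      have "splice t y x \<noteq> splice t z x"
        using neq id_fin_perms by force
      then show ?thesis
        using R(2) mem by (simp add: total_on_def)
    qed
    \<comment> \<open>Either variant may be the better one; \<open>y\<close> and \<open>z\<close>
      can be swapped in the goal.\<close>
    then have "strictly R (splice t z x) (splice t y x) \<or> strictly R (splice t y x) (splice t z x)"
      using indiff_perm neq unfolding strictly_def by metis
    then show "\<exists>y\<in>X. \<exists>z\<in>X. \<exists>t. strictly R (splice t z x) (splice t y x)"
      using yz by blast
  qed
  have "closedin T (lower_contour X R y)"
    if "\<And>U. openin (upper_topology X R) U \<Longrightarrow> openin T U" "y \<in> X" for y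
  proof -
    \<comment> \<open>The complement is a subbasic set, and \<open>topspace T = X\<close> turns its
      openness into closedness of the contour set.\<close>
    have "openin T (X - lower_contour X R y)"
      using that unfolding upper_topology_def by (blast intro: topology_generated_by_Basis)
    then show ?thesis
      using assms(2) by (auto simp: closedin_def lower_contour_def)
  qed
  moreover have "closedin T (upper_contour X R y)"
    if "\<And>U. openin (lower_topology X R) U \<Longrightarrow> openin T U" "y \<in> X" for y
  proof -
    have "openin T (X - upper_contour X R y)"
      using that unfolding lower_topology_def by (blast intro: topology_generated_by_Basis)
    then show ?thesis
      using assms(2) by (auto simp: closedin_def upper_contour_def)
  qed
  moreover have "openin (join_topology T1 T2) U" if "openin T1 U \<or> openin T2 U"
    for T1 T2 :: "(nat \<Rightarrow> real) topology" and U
    using that unfolding join_topology_def by (blast intro: topology_generated_by_Basis)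
  ultimately have "finer_topology T (join_topology (upper_topology X R) (lower_topology X R)) \<longrightarrow>
      continuous_pref T X R" "finer_topology T (upper_topology X R) \<longrightarrow> lower_continuous_pref T X R"
    unfolding finer_topology_def continuous_pref_def lower_continuous_pref_def by simp_all
  then show ?thesis
    using swo anon sens by blast
qed

end
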